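(* If $G$ is a simple oriented hypergraph with vertex set $V=\{v_1,\dots,v_n\}$, then $L_G=-W_{(G,V,V,1)}$.
   Context: An oriented hypergraph $G=(V,E,\mathcal{I},\sigma)$ consists of disjoint finite sets $V$, $E$, an incidence function $\iota:V\times E\to\mathbb{Z}_{\ge0}$, incidences $(v,e,k)$ with $1\le k\le\iota(v,e)$, and $\sigma:\mathcal{I}\to\{+1,-1\}$. Simple means $\iota(v,e)\le1$; write $(v,e)$ for $(v,e,1)$. For simple $G$: $sgn_e(v,w)=-\sigma(v,e)\sigma(w,e)$ if $(v,e),(w,e)$ are distinct incidences and $0$ otherwise; $A_G=[a_{ij}]$, $a_{ij}=\sum_e sgn_e(v_i,v_j)$; $D_G=\mathrm{diag}(\deg v_1,\dots,\deg v_n)$ with $\deg v$ the number of incidences containing $v$; $L_G=D_G-A_G$. A weak walk is a sequence $W=a_0,i_1,a_1,\dots,i_n,a_n$ where $a_0,\dots,a_n$ alternate between vertices and edges and each $i_h$ is an incidence containing $a_{h-1}$ and $a_h$ (repetition $i_{2h-1}=i_{2h}$ allowed); its length is $n/2$ and its sign is $(-1)^{\lfloor n/2\rfloor}\prod_{h=1}^n\sigma(i_h)$. $\widetilde{w}^{\pm}(a,b;k)$ is the number of positive weak walks of length $k$ from $a$ to $b$ minus the number of negative ones. The weak walk matrix $W_{(G,V,V,1)}$ is the $V\times V$ matrix with $(i,j)$-entry $\widetilde{w}^{\pm}(v_i,v_j;1)$. *)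

theory Defs
  imports "Jordan_Normal_Form.Matrix"
begin

text \<open>
  Vertices and edges live in one type, so that a weak walk can pass through both; a
  triple \<open>(v, e, k)\<close> is the \<open>k\<close>-th incidence between \<open>v\<close> and \<open>e\<close>.
\<close>

type_synonym 'a incidence = "'a \<times> 'a \<times> nat"

record 'a oriented_hypergraph =
  verts :: "'a set"
  edges :: "'a set"
  iota :: "'a \<Rightarrow> 'a \<Rightarrow> nat"
  sigma :: "'a incidence \<Rightarrow> int"

definition incidences :: "'a oriented_hypergraph \<Rightarrow> 'a incidence set" where
  "incidences G =
     {(v, e, k). v \<in> verts G \<and> e \<in> edges G \<and> 1 \<le> k \<and> k \<le> iota G v e}"

text \<open>
  The values of \<open>iota\<close> outside \<open>verts G \<times> edges G\<close> and of \<open>sigma\<close> outside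
  \<open>incidences G\<close> are junk and left unconstrained.
\<close>

locale oriented_hypergraph =
  fixes G :: "'a oriented_hypergraph"
  assumes finite_verts: "finite (verts G)"
    and finite_edges: "finite (edges G)"
    and disjoint: "verts G \<inter> edges G = {}"
    and sigma_values: "i \<in> incidences G \<Longrightarrow> sigma G i \<in> {1, -1}"

definition simple_hypergraph :: "'a oriented_hypergraph \<Rightarrow> bool" where
  "simple_hypergraph G \<longleftrightarrow> (\<forall>v\<in>verts G. \<forall>e\<in>edges G. iota G v e \<le> 1)"

text \<open>For simple hypergraphs; the incidence written \<open>(v, e)\<close> is \<open>(v, e, 1)\<close>.\<close>

definition adj_sign :: "'a oriented_hypergraph \<Rightarrow> 'a \<Rightarrow> 'a \<Rightarrow> 'a \<Rightarrow> int" where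
  "adj_sign G e v w =
     (if (v, e, 1) \<in> incidences G \<and> (w, e, 1) \<in> incidences G \<and> (v, e, 1 :: nat) \<noteq> (w, e, 1)
      then - sigma G (v, e, 1) * sigma G (w, e, 1) else 0)"

definition degree :: "'a oriented_hypergraph \<Rightarrow> 'a \<Rightarrow> nat" where
  "degree G v = card {i \<in> incidences G. fst i = v}"

text \<open>
  The matrices are taken with respect to an enumeration \<open>vs\<close> of the vertex set: the
  index \<open>i < length vs\<close> stands for the vertex \<open>vs ! i\<close>.
\<close>

definition adjacency_matrix :: "'a oriented_hypergraph \<Rightarrow> 'a list \<Rightarrow> int mat" where
  "adjacency_matrix G vs = mat (length vs) (length vs)
     (\<lambda>(i, j). \<Sum>e\<in>edges G. adj_sign G e (vs ! i) (vs ! j))"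

definition degree_matrix :: "'a oriented_hypergraph \<Rightarrow> 'a list \<Rightarrow> int mat" where
  "degree_matrix G vs = mat_diag (length vs) (\<lambda>i. int (degree G (vs ! i)))"

definition laplacian_matrix :: "'a oriented_hypergraph \<Rightarrow> 'a list \<Rightarrow> int mat" where
  "laplacian_matrix G vs = degree_matrix G vs - adjacency_matrix G vs"

text \<open>
  The walk \<open>a\<^sub>0, i\<^sub>1, a\<^sub>1, \<dots>, i\<^sub>n, a\<^sub>n\<close> is encoded as the pair of lists
  \<open>([a\<^sub>0, \<dots>, a\<^sub>n], [i\<^sub>1, \<dots>, i\<^sub>n])\<close>, so \<open>is ! h\<close> is \<open>i\<^bsub>h+1\<^esub>\<close>.
\<close>

type_synonym 'a walk = "'a list \<times> 'a incidence list"

fun incidence_contains :: "'a incidence \<Rightarrow> 'a \<Rightarrow> bool" where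
  "incidence_contains (v, e, k) a \<longleftrightarrow> a = v \<or> a = e"

fun weak_walk :: "'a oriented_hypergraph \<Rightarrow> 'a walk \<Rightarrow> bool" where
  "weak_walk G (as, is) \<longleftrightarrow>
     length as = Suc (length is) \<and>
     set as \<subseteq> verts G \<union> edges G \<and>
     (\<forall>h < length is.
        (as ! h \<in> verts G \<and> as ! Suc h \<in> edges G \<or>
         as ! h \<in> edges G \<and> as ! Suc h \<in> verts G) \<and>
        is ! h \<in> incidences G \<and>
        incidence_contains (is ! h) (as ! h) \<and>
        incidence_contains (is ! h) (as ! Suc h))"

text \<open>Half-integral: a single passage between a vertex and an edge has length \<open>1/2\<close>.\<close>

fun walk_length :: "'a walk \<Rightarrow> rat" where
  "walk_length (as, is) = of_nat (length is) / 2"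

fun walk_sign :: "'a oriented_hypergraph \<Rightarrow> 'a walk \<Rightarrow> int" where
  "walk_sign G (as, is) = (-1) ^ (length is div 2) * prod_list (map (sigma G) is)"

definition weak_walks :: "'a oriented_hypergraph \<Rightarrow> 'a \<Rightarrow> 'a \<Rightarrow> rat \<Rightarrow> 'a walk set" where
  "weak_walks G a b k =
     {W. weak_walk G W \<and> walk_length W = k \<and> hd (fst W) = a \<and> last (fst W) = b}"

definition signed_weak_walks :: "'a oriented_hypergraph \<Rightarrow> 'a \<Rightarrow> 'a \<Rightarrow> rat \<Rightarrow> int" where
  "signed_weak_walks G a b k =
     int (card {W \<in> weak_walks G a b k. walk_sign G W = 1})
     - int (card {W \<in> weak_walks G a b k. walk_sign G W = -1})"

text \<open>
  The lists \<open>xs\<close> and \<open>ys\<close> enumerate the sets of vertices or edges indexing the rows and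
  the columns.
\<close>

definition weak_walk_matrix ::
    "'a oriented_hypergraph \<Rightarrow> 'a list \<Rightarrow> 'a list \<Rightarrow> rat \<Rightarrow> int mat" where
  "weak_walk_matrix G xs ys k = mat (length xs) (length ys)
     (\<lambda>(i, j). signed_weak_walks G (xs ! i) (ys ! j) k)"

end

theory Submission
  imports Defs
begin

text \<open>In a simple oriented hypergraph a weak walk of length one from a vertex \<open>v\<close>
  to a vertex \<open>w\<close> is determined by its middle edge \<open>e\<close>, which may be any
  edge incident to both (\<open>weak_walks_length_one\<close>). Its sign is
  \<open>- sigma G (v, e, 1) * sigma G (w, e, 1)\<close>, so the signed count is minus the sum of
  these products over the common edges (\<open>signed_weak_walks_length_one\<close>). For
  \<open>v \<noteq> w\<close> this sum is the adjacency entry (\<open>sum_adj_sign\<close>). For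
  \<open>v = w\<close> every product is a square, hence 1, and the count is minus the degree
  (\<open>signed_weak_walks_eq_degree\<close>). As the adjacency matrix has zero diagonal, both
  cases give minus the Laplacian entry.\<close>

lemma sum_sign_eq_card_diff:
  fixes f :: "'a \<Rightarrow> int"
  assumes "finite S" and "\<And>x. x \<in> S \<Longrightarrow> f x \<in> {1, -1}"
  shows "int (card {x \<in> S. f x = 1}) - int (card {x \<in> S. f x = -1}) = sum f S"
proof -
  have "sum f S = sum f ({x \<in> S. f x = 1} \<union> {x \<in> S. f x = -1})"
    by (rule arg_cong[where f = "sum f"]) (use assms(2) in auto)
  also have "\<dots> = sum f {x \<in> S. f x = 1} + sum f {x \<in> S. f x = -1}"
    by (rule sum.union_disjoint) (use assms(1) in auto)
  also have "\<dots> = (\<Sum>x | x \<in> S \<and> f x = 1. 1) + (\<Sum>x | x \<in> S \<and> f x = -1. -1)"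
    by (intro arg_cong2[where f = "(+)"] sum.cong) auto
  finally show ?thesis by simp
qed

text \<open>The case \<open>v = w\<close> is deliberately allowed: it gives the edges incident to
  \<open>v\<close>, so one index set serves both the adjacency and the degree entries.\<close>

definition common_edges :: "'a oriented_hypergraph \<Rightarrow> 'a \<Rightarrow> 'a \<Rightarrow> 'a set" where
  "common_edges G v w = {e. (v, e, 1) \<in> incidences G \<and> (w, e, 1) \<in> incidences G}"

lemma common_edges_subset: "common_edges G v w \<subseteq> edges G"
  by (auto simp: common_edges_def incidences_def)

lemma simple_incidence_index:
  assumes "simple_hypergraph G" and "(v, e, k) \<in> incidences G"
  shows "k = 1"
proof -
  have "v \<in> verts G" "e \<in> edges G" "1 \<le> k" "k \<le> iota G v e"
    using assms(2) by (simp_all add: incidences_def)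
  moreover from this have "iota G v e \<le> 1"
    using assms(1) by (simp add: simple_hypergraph_def)
  ultimately show ?thesis by linarith
qed

text \<open>Simplicity forces index 1, so an incidence at \<open>v\<close> is determined by its
  edge.\<close>

lemma degree_simple:
  assumes "simple_hypergraph G"
  shows "degree G v = card (common_edges G v v)"
proof -
  have "{i \<in> incidences G. fst i = v} = (\<lambda>e. (v, e, 1)) ` common_edges G v v"
  proof (intro equalityI subsetI)
    fix i assume i: "i \<in> {i \<in> incidences G. fst i = v}"
    then obtain e k where "i = (v, e, k)" by (cases i) auto
    moreover from this i have "k = 1"
      using simple_incidence_index[OF assms] by blast
    ultimately show "i \<in> (\<lambda>e. (v, e, 1)) ` common_edges G v v"
      using i by (auto simp: common_edges_def)
  qed (auto simp: common_edges_def)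
  then show ?thesis
    by (simp add: degree_def card_image inj_on_def)
qed

context oriented_hypergraph
begin

lemma finite_common_edges: "finite (common_edges G v w)"
  using common_edges_subset finite_edges by (rule finite_subset)

text \<open>Disjointness of vertices and edges prevents \<open>v\<close> from filling the edge slot
  of \<open>i\<close> or \<open>e\<close> the vertex slot; simplicity then fixes the index.\<close>

lemma incidence_between:
  assumes "i \<in> incidences G" and "simple_hypergraph G" and "v \<in> verts G" and "e \<in> edges G"
    and "incidence_contains i v" and "incidence_contains i e"
  shows "i = (v, e, 1)"
proof -
  obtain v' e' k where i: "i = (v', e', k)" by (cases i)
  have "v' \<in> verts G" "e' \<in> edges G" using assms(1) by (auto simp: i incidences_def)
  then have "v = v'" "e = e'" using assms(3-6) disjoint by (auto simp: i)
  then show ?thesis using simple_incidence_index[OF assms(2)] assms(1) i by blast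
qed

text \<open>Length one means two incidences and three entries. If \<open>v = w\<close>, the two
  incidences coincide and the walk is a backstep.\<close>

lemma weak_walks_length_one:
  assumes simple: "simple_hypergraph G" and v: "v \<in> verts G" and w: "w \<in> verts G"
  shows "weak_walks G v w 1
    = (\<lambda>e. ([v, e, w], [(v, e, 1), (w, e, 1)])) ` common_edges G v w"
proof (intro equalityI subsetI)
  fix W assume "W \<in> weak_walks G v w 1"
  moreover obtain as "is" where W: "W = (as, is)" by (cases W)
  ultimately have walk: "weak_walk G (as, is)" and len: "length is = 2"
    and ends: "hd as = v" "last as = w"
    by (auto simp: weak_walks_def)
  obtain i j where ij: "is = [i, j]"
    using len by (auto simp: numeral_2_eq_2 length_Suc_conv)
  have "length as = 3" using walk len by simp
  then obtain e where as: "as = [v, e, w]"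
    using ends by (auto simp: numeral_3_eq_3 length_Suc_conv)
  have "\<forall>h<2. (as ! h \<in> verts G \<and> as ! Suc h \<in> edges G \<or>
         as ! h \<in> edges G \<and> as ! Suc h \<in> verts G) \<and> is ! h \<in> incidences G \<and>
        incidence_contains (is ! h) (as ! h) \<and> incidence_contains (is ! h) (as ! Suc h)"
    using walk len by simp
  \<comment> \<open>As \<open>v\<close> is a vertex and hence no edge, alternation makes the middle
    entry an edge.\<close>
  from this[rule_format, of 0] this[rule_format, of 1]
  have e: "e \<in> edges G" and i: "i \<in> incidences G" "incidence_contains i v" "incidence_contains i e"
    and j: "j \<in> incidences G" "incidence_contains j w" "incidence_contains j e"
    using v disjoint by (auto simp: as ij)
  have "i = (v, e, 1)" "j = (w, e, 1)"
    using incidence_between simple v w e i j by blast+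
  then show "W \<in> (\<lambda>e. ([v, e, w], [(v, e, 1), (w, e, 1)])) ` common_edges G v w"
    using i j by (auto simp: W as ij common_edges_def)
next
  fix W :: "'a walk"
  assume "W \<in> (\<lambda>e. ([v, e, w], [(v, e, 1), (w, e, 1)])) ` common_edges G v w"
  then show "W \<in> weak_walks G v w 1"
    using v w common_edges_subset[of G v w]
    by (auto simp: weak_walks_def common_edges_def less_Suc_eq)
qed

text \<open>Each walk carries the factor \<open>(-1) ^ (2 div 2)\<close>, which is the source of the
  minus sign.\<close>

lemma signed_weak_walks_length_one:
  assumes "simple_hypergraph G" and "v \<in> verts G" and "w \<in> verts G"
  shows "signed_weak_walks G v w 1
    = - (\<Sum>e\<in>common_edges G v w. sigma G (v, e, 1) * sigma G (w, e, 1))"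
proof -
  let ?W = "\<lambda>e. ([v, e, w], [(v, e, 1), (w, e, 1)]) :: 'a walk"
  have sign: "walk_sign G (?W e) \<in> {1, -1}" if "e \<in> common_edges G v w" for e
    using that sigma_values[of "(v, e, 1)"] sigma_values[of "(w, e, 1)"]
    by (auto simp: common_edges_def)
  have "signed_weak_walks G v w 1 = sum (walk_sign G) (?W ` common_edges G v w)"
    unfolding signed_weak_walks_def weak_walks_length_one[OF assms]
    by (rule sum_sign_eq_card_diff) (use sign finite_common_edges in blast)+
  \<comment> \<open>The edge can be read off the walk as its middle entry, so \<open>?W\<close> is
    injective.\<close>
  also have "\<dots> = (\<Sum>e\<in>common_edges G v w. walk_sign G (?W e))"
    by (subst sum.reindex) (auto simp: inj_on_def)
  finally show ?thesis by (simp add: sum_negf)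
qed

lemma sum_adj_sign:
  assumes "v \<noteq> w"
  shows "(\<Sum>e\<in>edges G. adj_sign G e v w)
    = - (\<Sum>e\<in>common_edges G v w. sigma G (v, e, 1) * sigma G (w, e, 1))"
proof -
  \<comment> \<open>Edges missing \<open>v\<close> or \<open>w\<close> contribute 0 by the default
    value of \<open>adj_sign\<close>.\<close>
  have "(\<Sum>e\<in>edges G. adj_sign G e v w) = (\<Sum>e\<in>common_edges G v w. adj_sign G e v w)"
    by (rule sum.mono_neutral_right)
      (use finite_edges common_edges_subset[of G v w] in
        \<open>auto simp: common_edges_def adj_sign_def\<close>)
  also have "\<dots> = (\<Sum>e\<in>common_edges G v w. - (sigma G (v, e, 1) * sigma G (w, e, 1)))"
    by (rule sum.cong) (use assms in \<open>auto simp: common_edges_def adj_sign_def\<close>)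
  finally show ?thesis by (simp add: sum_negf)
qed

lemma signed_weak_walks_eq_adjacency:
  assumes "simple_hypergraph G" and "v \<in> verts G" and "w \<in> verts G" and "v \<noteq> w"
  shows "signed_weak_walks G v w 1 = (\<Sum>e\<in>edges G. adj_sign G e v w)"
  using assms by (simp add: signed_weak_walks_length_one sum_adj_sign)

text \<open>The closed walks of length one are backsteps, and each of them is negative.\<close>

lemma signed_weak_walks_eq_degree:
  assumes "simple_hypergraph G" and "v \<in> verts G"
  shows "signed_weak_walks G v v 1 = - int (degree G v)"
proof -
  have "(\<Sum>e\<in>common_edges G v v. sigma G (v, e, 1) * sigma G (v, e, 1))
      = (\<Sum>e\<in>common_edges G v v. 1)"
    by (rule sum.cong) (use sigma_values in \<open>force simp: common_edges_def\<close>)+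
  then show ?thesis
    using assms by (simp add: signed_weak_walks_length_one degree_simple)
qed

end

theorem theorem5p8:
  fixes G :: "'a oriented_hypergraph" and vs :: "'a list"
  assumes "oriented_hypergraph G"
    and "simple_hypergraph G"
    and "distinct vs" and "set vs = verts G"
  shows "laplacian_matrix G vs = - weak_walk_matrix G vs vs 1"
proof -
  interpret oriented_hypergraph G by fact
  have entry: "(if i = j then int (degree G (vs ! i)) else 0)
        - (\<Sum>e\<in>edges G. adj_sign G e (vs ! i) (vs ! j))
      = - signed_weak_walks G (vs ! i) (vs ! j) 1"
    if "i < length vs" "j < length vs" for i j
  proof (cases "i = j")
    case True
    \<comment> \<open>On the diagonal the two incidences in \<open>adj_sign\<close> are equal, so
      the adjacency sum vanishes and only the degree remains.\<close>
    then show ?thesis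
      using signed_weak_walks_eq_degree assms(2,4) that nth_mem by (fastforce simp: adj_sign_def)
  next
    case False
    \<comment> \<open>Distinctness of \<open>vs\<close> makes off-diagonal positions correspond to
      different vertices.\<close>
    then have "vs ! i \<noteq> vs ! j" using assms(3) that by (simp add: nth_eq_iff_index_eq)
    then have "signed_weak_walks G (vs ! i) (vs ! j) 1
        = (\<Sum>e\<in>edges G. adj_sign G e (vs ! i) (vs ! j))"
      using signed_weak_walks_eq_adjacency assms(2,4) that nth_mem by blast
    with False show ?thesis by simp
  qed
  show ?thesis
  proof (rule eq_matI)
    fix i j
    assume "i < dim_row (- weak_walk_matrix G vs vs 1)"
      and "j < dim_col (- weak_walk_matrix G vs vs 1)"
    then have "i < length vs" "j < length vs" by (simp_all add: weak_walk_matrix_def)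
    then show "laplacian_matrix G vs $$ (i, j) = (- weak_walk_matrix G vs vs 1) $$ (i, j)"
      using entry[of i j]
      by (cases "i = j") (simp_all add: laplacian_matrix_def degree_matrix_def adjacency_matrix_def
          weak_walk_matrix_def mat_diag_def)
  qed (simp_all add: laplacian_matrix_def adjacency_matrix_def weak_walk_matrix_def)
qed

end
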